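(* Let $W$ and $Z$ be two Banach spaces, and let $T\in\mathcal{L}(W,Z)$ with $\|T\|=1$. Define $\widetilde{T}\in\mathcal{L}(W\oplus_1 Z)$ by $\widetilde{T}(w,z)=(0,Tw)$ for every $(w,z)\in W\oplus_1 Z$. Then: (a) If $\widetilde{T}\in\mathcal{A}_{\mathrm{nu}}(W\oplus_1 Z)$, then $T\in\mathcal{A}_{\|\cdot\|}(W,Z)$. (b) Suppose that $W$ and $Z$ are uniformly smooth Banach spaces. If $T\in\mathcal{A}_{\|\cdot\|}(W,Z)$, then $\widetilde{T}\in\mathcal{A}_{\mathrm{nu}}(W\oplus_1 Z)$.
   Context: Banach spaces are over $\mathbb{K}=\mathbb{R}$ or $\mathbb{C}$; $W\oplus_1 Z$ is the direct sum with norm $\|(w,z)\|_1=\|w\|+\|z\|$. $S_X$ is the unit sphere of $X$, $X^*$ the topological dual, $\mathcal{L}(X,Y)$ the bounded linear operators from $X$ to $Y$, $\mathcal{L}(X)=\mathcal{L}(X,X)$, and $\langle x^*,x\rangle=x^*(x)$. An operator $T\in\mathcal{L}(X,Y)$ attains its norm if $\|T(x_0)\|=\|T\|$ for some $x_0\in S_X$. Let $\Pi(X)=\{(x,x^* )\in S_X\times S_{X^*}:\langle x^*,x\rangle=1\}$ and, for $T\in\mathcal{L}(X)$, $\nu(T)=\sup\{|\langle x^*,T(x)\rangle|:(x,x^* )\in\Pi(X)\}$; $T$ attains its numerical radius if this supremum is attained. $\mathcal{A}_{\|\cdot\|}(X,Y)$ is the set of all norm-attaining $T\in\mathcal{L}(X,Y)$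 with $\|T\|=1$ such that for every $\varepsilon>0$ there is $\eta(\varepsilon,T)>0$ such that whenever $x\in S_X$ satisfies $\|T(x)\|>1-\eta(\varepsilon,T)$, there is $x_0\in S_X$ with $\|T(x_0)\|=1$ and $\|x_0-x\|<\varepsilon$. $\mathcal{A}_{\mathrm{nu}}(X)$ is the set of all numerical radius attaining $T\in\mathcal{L}(X)$ with $\nu(T)=1$ such that for every $\varepsilon>0$ there is $\eta(\varepsilon,T)>0$ such that whenever $(x,x^* )\in\Pi(X)$ satisfies $|\langle x^*,T(x)\rangle|>1-\eta(\varepsilon,T)$, there is $(x_0,x_0^* )\in\Pi(X)$ with $|\langle x_0^*,T(x_0)\rangle|=1$, $\|x_0-x\|<\varepsilon$ and $\|x_0^*-x^*\|<\varepsilon$. *)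

theory Defs
  imports "HOL-Analysis.Analysis"
begin

(* The scalar field K: isometrically isomorphic, as a normed field, to R or to C. *)
class real_or_complex = real_normed_field +
  assumes real_or_complex_embedding:
    "\<exists>f :: 'a \<Rightarrow> complex.
       (\<forall>x y. f (x + y) = f x + f y) \<and> (\<forall>x y. f (x * y) = f x * f y) \<and>
       (\<forall>r. f (r *\<^sub>R 1) = of_real r) \<and> (\<forall>x. cmod (f x) = norm x) \<and>
       (range f = \<real> \<or> range f = UNIV)"

instance real :: real_or_complex
proof
  show "\<exists>f :: real \<Rightarrow> complex.
       (\<forall>x y. f (x + y) = f x + f y) \<and> (\<forall>x y. f (x * y) = f x * f y) \<and>
       (\<forall>r. f (r *\<^sub>R 1) = of_real r) \<and> (\<forall>x. cmod (f x) = norm x) \<and>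
       (range f = \<real> \<or> range f = UNIV)"
    by (rule exI[of _ complex_of_real]) (simp add: Reals_def)
qed

instance complex :: real_or_complex
proof
  show "\<exists>f :: complex \<Rightarrow> complex.
       (\<forall>x y. f (x + y) = f x + f y) \<and> (\<forall>x y. f (x * y) = f x * f y) \<and>
       (\<forall>r. f (r *\<^sub>R 1) = of_real r) \<and> (\<forall>x. cmod (f x) = norm x) \<and>
       (range f = \<real> \<or> range f = UNIV)"
    by (rule exI[of _ "\<lambda>x. x"]) (simp add: scaleR_conv_of_real)
qed

(* A Banach space over K. The class banach provides the norm, its completeness and the
   multiplication by real scalars, which the multiplication by K extends. *)
locale banach_space_over = vector_space scale
  for scale :: "'k::real_or_complex \<Rightarrow> 'a::banach \<Rightarrow> 'a" +
  assumes norm_scale: "norm (scale c x) = norm c * norm x"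
    and scale_of_real: "scale (of_real r) x = r *\<^sub>R x"

definition bounded_ops ::
  "('k::real_or_complex \<Rightarrow> 'x::real_normed_vector \<Rightarrow> 'x) \<Rightarrow>
   ('k \<Rightarrow> 'y::real_normed_vector \<Rightarrow> 'y) \<Rightarrow> ('x \<Rightarrow> 'y) set" where
  "bounded_ops sX sY = {T. Vector_Spaces.linear sX sY T \<and> (\<exists>C. \<forall>x. norm (T x) \<le> C * norm x)}"

abbreviation dual_space ::
  "('k::real_or_complex \<Rightarrow> 'x::real_normed_vector \<Rightarrow> 'x) \<Rightarrow> ('x \<Rightarrow> 'k) set" where
  "dual_space sX \<equiv> bounded_ops sX (*)"

definition attains_norm :: "('x::real_normed_vector \<Rightarrow> 'y::real_normed_vector) \<Rightarrow> bool" where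
  "attains_norm T \<longleftrightarrow> (\<exists>x0 \<in> sphere 0 1. norm (T x0) = onorm T)"

definition states ::
  "('k::real_or_complex \<Rightarrow> 'x::real_normed_vector \<Rightarrow> 'x) \<Rightarrow> ('x \<times> ('x \<Rightarrow> 'k)) set" where
  "states sX = {(x, x'). x \<in> sphere 0 1 \<and> x' \<in> dual_space sX \<and> onorm x' = 1 \<and> x' x = 1}"

(* For bounded T and nonzero X the supremum is over a nonempty bounded set. If X = 0 then the
   set of states is empty and the value is arbitrary, but T then attains no numerical radius. *)
definition numerical_radius ::
  "('k::real_or_complex \<Rightarrow> 'x::real_normed_vector \<Rightarrow> 'x) \<Rightarrow> ('x \<Rightarrow> 'x) \<Rightarrow> real" where
  "numerical_radius sX T = (SUP (x, x') \<in> states sX. norm (x' (T x)))"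

definition attains_numerical_radius ::
  "('k::real_or_complex \<Rightarrow> 'x::real_normed_vector \<Rightarrow> 'x) \<Rightarrow> ('x \<Rightarrow> 'x) \<Rightarrow> bool" where
  "attains_numerical_radius sX T \<longleftrightarrow>
     (\<exists>(x, x') \<in> states sX. norm (x' (T x)) = numerical_radius sX T)"

definition A_norm ::
  "('k::real_or_complex \<Rightarrow> 'x::real_normed_vector \<Rightarrow> 'x) \<Rightarrow>
   ('k \<Rightarrow> 'y::real_normed_vector \<Rightarrow> 'y) \<Rightarrow> ('x \<Rightarrow> 'y) set" where
  "A_norm sX sY = {T \<in> bounded_ops sX sY. attains_norm T \<and> onorm T = 1 \<and>
     (\<forall>\<epsilon>>0. \<exists>\<eta>>0. \<forall>x \<in> sphere 0 1. norm (T x) > 1 - \<eta> \<longrightarrow>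
        (\<exists>x0 \<in> sphere 0 1. norm (T x0) = 1 \<and> norm (x0 - x) < \<epsilon>))}"

definition A_nu ::
  "('k::real_or_complex \<Rightarrow> 'x::real_normed_vector \<Rightarrow> 'x) \<Rightarrow> ('x \<Rightarrow> 'x) set" where
  "A_nu sX = {T \<in> bounded_ops sX sX. attains_numerical_radius sX T \<and> numerical_radius sX T = 1 \<and>
     (\<forall>\<epsilon>>0. \<exists>\<eta>>0. \<forall>(x, x') \<in> states sX. norm (x' (T x)) > 1 - \<eta> \<longrightarrow>
        (\<exists>(x0, x0') \<in> states sX. norm (x0' (T x0)) = 1 \<and>
           norm (x0 - x) < \<epsilon> \<and> onorm (\<lambda>y. x0' y - x' y) < \<epsilon>))}"

definition uniformly_smooth :: "'a::real_normed_vector itself \<Rightarrow> bool" where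
  "uniformly_smooth _ \<longleftrightarrow>
     (\<forall>\<epsilon>>0. \<exists>\<delta>>0. \<forall>x y :: 'a. norm x = 1 \<longrightarrow> norm y \<le> \<delta> \<longrightarrow>
        norm (x + y) + norm (x - y) \<le> 2 + \<epsilon> * norm y)"

(* The product type of the library carries the Euclidean product norm, so the direct sum with
   norm |w| + |z| needs a type of its own. *)
datatype ('w, 'z) l1_sum = L1 (l1_fst: 'w) (l1_snd: 'z)

instantiation l1_sum :: (real_normed_vector, real_normed_vector) real_normed_vector
begin

definition "0 = L1 0 0"
definition "p + q = L1 (l1_fst p + l1_fst q) (l1_snd p + l1_snd q)"
definition "- p = L1 (- l1_fst p) (- l1_snd p)"
definition "p - q = L1 (l1_fst p - l1_fst q) (l1_snd p - l1_snd q)"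
definition "r *\<^sub>R p = L1 (r *\<^sub>R l1_fst p) (r *\<^sub>R l1_snd p)"
definition "norm p = norm (l1_fst p) + norm (l1_snd p)"
definition "sgn p = inverse (norm p) *\<^sub>R p" for p :: "('a, 'b) l1_sum"
definition "dist p q = norm (p - q)" for p q :: "('a, 'b) l1_sum"
definition uniformity_l1_sum :: "(('a, 'b) l1_sum \<times> ('a, 'b) l1_sum) filter" where
  "uniformity_l1_sum = (INF e\<in>{0 <..}. principal {(x, y). dist x y < e})"
definition open_l1_sum :: "('a, 'b) l1_sum set \<Rightarrow> bool" where
  "open_l1_sum U \<longleftrightarrow> (\<forall>x\<in>U. eventually (\<lambda>(x', y). x' = x \<longrightarrow> y \<in> U) uniformity)"

instance
proof
  fix p q r :: "('a, 'b) l1_sum" and a b :: real and U :: "('a, 'b) l1_sum set"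
  show "p + q + r = p + (q + r)" "p + q = q + p" "0 + p = p" "- p + p = 0" "p - q = p + - q"
    "a *\<^sub>R (p + q) = a *\<^sub>R p + a *\<^sub>R q" "(a + b) *\<^sub>R p = a *\<^sub>R p + b *\<^sub>R p"
    "a *\<^sub>R b *\<^sub>R p = (a * b) *\<^sub>R p" "1 *\<^sub>R p = p"
    by (simp_all add: zero_l1_sum_def plus_l1_sum_def uminus_l1_sum_def minus_l1_sum_def
      scaleR_l1_sum_def algebra_simps)
  show "sgn p = inverse (norm p) *\<^sub>R p" by (rule sgn_l1_sum_def)
  show "dist p q = norm (p - q)" by (rule dist_l1_sum_def)
  show "uniformity = (INF e\<in>{0 <..}. principal {(x, y :: ('a, 'b) l1_sum). dist x y < e})"
    by (rule uniformity_l1_sum_def)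
  show "open U \<longleftrightarrow> (\<forall>x\<in>U. eventually (\<lambda>(x', y). x' = x \<longrightarrow> y \<in> U) uniformity)"
    by (rule open_l1_sum_def)
  show "norm (p + q) \<le> norm p + norm q"
    using norm_triangle_ineq[of "l1_fst p" "l1_fst q"] norm_triangle_ineq[of "l1_snd p" "l1_snd q"]
    by (simp add: norm_l1_sum_def plus_l1_sum_def)
  show "norm p = 0 \<longleftrightarrow> p = 0"
    by (cases p) (simp add: norm_l1_sum_def zero_l1_sum_def add_nonneg_eq_0_iff)
  show "norm (a *\<^sub>R p) = \<bar>a\<bar> * norm p"
    by (simp add: norm_l1_sum_def scaleR_l1_sum_def distrib_left)
qed

end

instance l1_sum :: (banach, banach) banach
proof
  fix X :: "nat \<Rightarrow> ('a, 'b) l1_sum"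
  assume X: "Cauchy X"
  have nd: "dist p q = dist (l1_fst p) (l1_fst q) + dist (l1_snd p) (l1_snd q)"
    for p q :: "('a, 'b) l1_sum"
    by (simp add: dist_l1_sum_def norm_l1_sum_def minus_l1_sum_def dist_norm)
  have "Cauchy (\<lambda>n. l1_fst (X n))"
  proof (rule metric_CauchyI)
    fix e :: real assume "0 < e"
    then obtain M where M: "\<forall>m\<ge>M. \<forall>n\<ge>M. dist (X m) (X n) < e"
      using metric_CauchyD[OF X] by blast
    have "dist (l1_fst (X m)) (l1_fst (X n)) < e" if "m \<ge> M" "n \<ge> M" for m n
      using M[rule_format, OF that] zero_le_dist[of "l1_snd (X m)" "l1_snd (X n)"]
      unfolding nd by linarith
    then show "\<exists>M. \<forall>m\<ge>M. \<forall>n\<ge>M. dist (l1_fst (X m)) (l1_fst (X n)) < e" by blast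
  qed
  then obtain a where a: "(\<lambda>n. l1_fst (X n)) \<longlonglongrightarrow> a"
    using Cauchy_convergent convergent_def by blast
  have "Cauchy (\<lambda>n. l1_snd (X n))"
  proof (rule metric_CauchyI)
    fix e :: real assume "0 < e"
    then obtain M where M: "\<forall>m\<ge>M. \<forall>n\<ge>M. dist (X m) (X n) < e"
      using metric_CauchyD[OF X] by blast
    have "dist (l1_snd (X m)) (l1_snd (X n)) < e" if "m \<ge> M" "n \<ge> M" for m n
      using M[rule_format, OF that] zero_le_dist[of "l1_fst (X m)" "l1_fst (X n)"]
      unfolding nd by linarith
    then show "\<exists>M. \<forall>m\<ge>M. \<forall>n\<ge>M. dist (l1_snd (X m)) (l1_snd (X n)) < e" by blast
  qed
  then obtain b where b: "(\<lambda>n. l1_snd (X n)) \<longlonglongrightarrow> b"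
    using Cauchy_convergent convergent_def by blast
  have "(\<lambda>n. dist (X n) (L1 a b)) \<longlonglongrightarrow> 0"
    using tendsto_add[OF iffD1[OF tendsto_dist_iff a] iffD1[OF tendsto_dist_iff b]]
    by (simp only: nd l1_sum.sel add_0)
  then have "X \<longlonglongrightarrow> L1 a b"
    by (rule iffD2[OF tendsto_dist_iff])
  then show "convergent X"
    by (rule convergentI)
qed

definition l1_scale ::
  "('k \<Rightarrow> 'w \<Rightarrow> 'w) \<Rightarrow> ('k \<Rightarrow> 'z \<Rightarrow> 'z) \<Rightarrow> 'k \<Rightarrow> ('w, 'z) l1_sum \<Rightarrow> ('w, 'z) l1_sum" where
  "l1_scale sW sZ c p = L1 (sW c (l1_fst p)) (sZ c (l1_snd p))"

lemma banach_space_over_l1_scale: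
  assumes "banach_space_over sW" and "banach_space_over sZ"
  shows "banach_space_over (l1_scale sW sZ)"
proof -
  interpret W: banach_space_over sW by fact
  interpret Z: banach_space_over sZ by fact
  show ?thesis
    by standard (auto simp: l1_scale_def plus_l1_sum_def norm_l1_sum_def scaleR_l1_sum_def
      W.scale_right_distrib Z.scale_right_distrib W.scale_left_distrib Z.scale_left_distrib
      W.norm_scale Z.norm_scale W.scale_of_real Z.scale_of_real algebra_simps)
qed

definition tilde_op :: "('w \<Rightarrow> 'z) \<Rightarrow> ('w::zero, 'z) l1_sum \<Rightarrow> ('w, 'z) l1_sum" where
  "tilde_op T p = L1 0 (T (l1_fst p))"

lemma tilde_op_in_bounded_ops:
  assumes W: "banach_space_over sW" and Z: "banach_space_over sZ" and T: "T \<in> bounded_ops sW sZ"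
  shows "tilde_op T \<in> bounded_ops (l1_scale sW sZ) (l1_scale sW sZ)"
proof -
  interpret W: banach_space_over sW by fact
  interpret Z: banach_space_over sZ by fact
  interpret S: banach_space_over "l1_scale sW sZ" using W Z by (rule banach_space_over_l1_scale)
  from T obtain C where lin: "Vector_Spaces.linear sW sZ T" and C: "\<And>x. norm (T x) \<le> C * norm x"
    by (auto simp: bounded_ops_def)
  interpret T: Vector_Spaces.linear sW sZ T by fact
  have "Vector_Spaces.linear (l1_scale sW sZ) (l1_scale sW sZ) (tilde_op T)"
    by standard (auto simp: tilde_op_def l1_scale_def plus_l1_sum_def T.add T.scale)
  moreover have "norm (tilde_op T p) \<le> \<bar>C\<bar> * norm p" for p
  proof -
    have "norm (T (l1_fst p)) \<le> \<bar>C\<bar> * norm (l1_fst p)"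
      using C[of "l1_fst p"] by (meson abs_ge_self mult_right_mono norm_ge_zero order_trans)
    also have "\<dots> \<le> \<bar>C\<bar> * norm p"
      by (rule mult_left_mono) (auto simp: norm_l1_sum_def)
    finally show ?thesis by (simp add: tilde_op_def norm_l1_sum_def)
  qed
  ultimately show ?thesis by (auto simp: bounded_ops_def)
qed

end

theory Submission
  imports Defs
begin

text \<open>
  A functional on the \<open>\<ell>\<^sub>1\<close>-sum is a pair of functionals \<open>(w', z')\<close>, and its value at \<open>T~(w, z)\<close> is
  \<open>z' (T w)\<close>. A state at which this is close to \<open>1\<close> in modulus therefore has \<open>norm (T w)\<close> and
  \<open>norm w\<close> close to \<open>1\<close> and \<open>z\<close> close to \<open>0\<close>. For (a), complete a unit vector \<open>w\<close> to a state
  \<open>((w, 0), (w', z'))\<close> with \<open>w'\<close> supporting \<open>w\<close> and \<open>z'\<close> supporting \<open>T w\<close>. For (b), move \<open>w\<close> to a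
  nearby \<open>w\<^sub>0\<close> where \<open>T\<close> attains its norm; \<open>w'\<close> and \<open>z'\<close> are then almost supporting at \<open>w\<^sub>0\<close> and, up
  to a unimodular factor, at \<open>T w\<^sub>0\<close>, and uniform smoothness moves them to exact support functionals
  without changing them much.
\<close>

subsection \<open>The Hahn--Banach theorem for a norm\<close>

definition sublinear :: "('a::real_vector \<Rightarrow> real) \<Rightarrow> bool" where
  "sublinear q \<longleftrightarrow> (\<forall>x y. q (x + y) \<le> q x + q y) \<and> (\<forall>r x. 0 < r \<longrightarrow> q (r *\<^sub>R x) = r * q x)"

text \<open>The one-sided bound, applied to \<open>inverse r\<close> and
  \<open>r *\<^sub>R x\<close>, already yields the reverse inequality.\<close>

lemma sublinearI:
  assumes add: "\<And>x y. q (x + y) \<le> q x + q y"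
    and le: "\<And>r x. 0 < r \<Longrightarrow> q (r *\<^sub>R x) \<le> r * q x"
  shows "sublinear q"
proof -
  have "r * q x \<le> q (r *\<^sub>R x)" if "0 < r" for r x
    using le[of "inverse r" "r *\<^sub>R x"] that by (simp add: field_simps)
  with le have "q (r *\<^sub>R x) = r * q x" if "0 < r" for r x
    using that by (meson order_antisym)
  with add show ?thesis by (simp add: sublinear_def)
qed

lemma sublinear_add: "sublinear q \<Longrightarrow> q (x + y) \<le> q x + q y"
  and sublinear_scale: "sublinear q \<Longrightarrow> 0 < r \<Longrightarrow> q (r *\<^sub>R x) = r * q x"
  by (simp_all add: sublinear_def)

lemma sublinear_zero: "sublinear q \<Longrightarrow> q 0 = 0"
  using sublinear_scale[of q 2 0] by simp

lemma sublinear_minus: "sublinear q \<Longrightarrow> - q (- x) \<le> q x"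
  using sublinear_add[of q x "- x"] sublinear_zero[of q] by simp

lemma sublinear_norm: "sublinear norm"
  by (rule sublinearI) (simp_all add: norm_triangle_ineq)

text \<open>Subadditivity at \<open>- x\<close> and \<open>- y\<close> becomes superadditivity at
  \<open>x\<close> and \<open>y\<close> once signs can be pulled out; oddness likewise reduces
  negative scalars to positive ones.\<close>

lemma sublinear_linear_if_odd:
  assumes q: "sublinear q" and odd: "\<And>x. q (- x) = - q x"
  shows "linear q"
proof (rule linearI)
  show "q (x + y) = q x + q y" for x y
    using sublinear_add[OF q, of x y] sublinear_add[OF q, of "- x" "- y"] odd[of "x + y"]
    by (simp add: odd)
  show "q (r *\<^sub>R x) = r *\<^sub>R q x" for r x
  proof -
    consider "0 < r" | "r = 0" | "0 < - r" by linarith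
    then show ?thesis
    proof cases
      case 1 then show ?thesis by (simp add: sublinear_scale[OF q])
    next
      case 2 then show ?thesis by (simp add: sublinear_zero[OF q])
    next
      case 3 then show ?thesis
        using sublinear_scale[OF q 3, of x] odd[of "r *\<^sub>R x"] by simp
    qed
  qed
qed

text \<open>Lowering \<open>q\<close> along \<open>x\<close> makes it odd at \<open>x\<close>.\<close>

definition lower_along :: "('a::real_vector \<Rightarrow> real) \<Rightarrow> 'a \<Rightarrow> 'a \<Rightarrow> real" where
  "lower_along q x y = (INF t\<in>{0..}. q (y + t *\<^sub>R x) - t * q x)"

lemma lower_along_le:
  assumes q: "sublinear q" and "0 \<le> t"
  shows "lower_along q x y \<le> q (y + t *\<^sub>R x) - t * q x"
  unfolding lower_along_def
proof (rule cINF_lower)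
  \<comment> \<open>This bound does not depend on \<open>s\<close>, so the infimum is a genuine
    one.\<close>
  have "- q (- y) \<le> q (y + s *\<^sub>R x) - s * q x" if "0 \<le> s" for s
  proof -
    have "q (s *\<^sub>R x) = s * q x"
      using that sublinear_scale[OF q, of s x] sublinear_zero[OF q] by (cases "s = 0") auto
    then show ?thesis using sublinear_add[OF q, of "y + s *\<^sub>R x" "- y"] by simp
  qed
  then show "bdd_below ((\<lambda>t. q (y + t *\<^sub>R x) - t * q x) ` {0..})"
    by (intro bdd_belowI2) auto
qed (use assms in auto)

lemma lower_along_greatest:
  "(\<And>t. 0 \<le> t \<Longrightarrow> b \<le> q (y + t *\<^sub>R x) - t * q x) \<Longrightarrow> b \<le> lower_along q x y"
  unfolding lower_along_def by (rule cINF_greatest) auto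

lemma lower_along_le_self: "sublinear q \<Longrightarrow> lower_along q x y \<le> q y"
  using lower_along_le[of q 0 x y] by simp

lemma lower_along_minus: "sublinear q \<Longrightarrow> lower_along q x (- x) \<le> - q x"
  using lower_along_le[of q 1 x "- x"] sublinear_zero[of q] by simp

text \<open>Parameters \<open>t\<close> for \<open>y\<close> and \<open>s\<close> for
  \<open>z\<close> give the competitor \<open>s + t\<close> for \<open>y + z\<close>, and the two
  infima are taken one after the other. Scaling \<open>y\<close> by \<open>r\<close> amounts to
  scaling the parameter by \<open>r\<close>.\<close>

lemma sublinear_lower_along:
  assumes q: "sublinear q"
  shows "sublinear (lower_along q x)"
proof (rule sublinearI)
  fix y z
  have *: "lower_along q x (y + z) - (q (y + t *\<^sub>R x) - t * q x) \<le> q (z + s *\<^sub>R x) - s * q x"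
    if "0 \<le> s" "0 \<le> t" for s t
    using lower_along_le[OF q, of "s + t" x "y + z"] that
      sublinear_add[OF q, of "y + t *\<^sub>R x" "z + s *\<^sub>R x"]
    by (simp add: algebra_simps)
  have "lower_along q x (y + z) - lower_along q x z \<le> q (y + t *\<^sub>R x) - t * q x" if "0 \<le> t" for t
    using lower_along_greatest[OF *[OF _ that]] by simp
  then have "lower_along q x (y + z) - lower_along q x z \<le> lower_along q x y"
    by (rule lower_along_greatest)
  then show "lower_along q x (y + z) \<le> lower_along q x y + lower_along q x z" by simp
next
  fix r :: real and y assume r: "0 < r"
  have "lower_along q x (r *\<^sub>R y) / r \<le> q (y + t *\<^sub>R x) - t * q x" if "0 \<le> t" for t
  proof -
    have "lower_along q x (r *\<^sub>R y) \<le> q (r *\<^sub>R (y + t *\<^sub>R x)) - r * t * q x"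
      using lower_along_le[OF q, of "r * t" x "r *\<^sub>R y"] r that by (simp add: algebra_simps)
    also have "\<dots> = r * (q (y + t *\<^sub>R x) - t * q x)"
      unfolding sublinear_scale[OF q r] by (simp add: algebra_simps)
    finally show ?thesis using r by (simp add: pos_divide_le_eq mult.commute)
  qed
  then have "lower_along q x (r *\<^sub>R y) / r \<le> lower_along q x y"
    by (rule lower_along_greatest)
  then show "lower_along q x (r *\<^sub>R y) \<le> r * lower_along q x y"
    using r by (simp add: pos_divide_le_eq mult.commute)
qed

text \<open>The chain condition for Zorn's lemma. Values at \<open>x\<close> stay above
  \<open>- p (- x)\<close>, so the pointwise infimum exists. For subadditivity, two members used for
  the two summands are replaced by the smaller of them.\<close>

lemma sublinear_Inf_chain:
  fixes C :: "('a::real_vector \<Rightarrow> real) set"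
  assumes ne: "C \<noteq> {}" and sub: "\<And>q. q \<in> C \<Longrightarrow> sublinear q"
    and le: "\<And>q x. q \<in> C \<Longrightarrow> q x \<le> p x"
    and chain: "\<And>q q'. q \<in> C \<Longrightarrow> q' \<in> C \<Longrightarrow> q \<le> q' \<or> q' \<le> q"
  shows "sublinear (\<lambda>x. INF q\<in>C. q x)" and "\<And>q x. q \<in> C \<Longrightarrow> (INF q\<in>C. q x) \<le> q x"
proof -
  show low: "(INF q\<in>C. q x) \<le> q x" if "q \<in> C" for q x
  proof (rule cINF_lower[OF _ that])
    have "- p (- x) \<le> q x" if "q \<in> C" for q
      using sublinear_minus[OF sub[OF that], of x] le[OF that, of "- x"] by linarith
    then show "bdd_below ((\<lambda>q. q x) ` C)" by (intro bdd_belowI2)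
  qed
  show "sublinear (\<lambda>x. INF q\<in>C. q x)"
  proof (rule sublinearI)
    fix x y
    have *: "(INF q\<in>C. q (x + y)) - q' x \<le> q y" if "q \<in> C" "q' \<in> C" for q q'
    proof -
      obtain m where m: "m \<in> C" "m \<le> q" "m \<le> q'"
        using chain[OF \<open>q \<in> C\<close> \<open>q' \<in> C\<close>] \<open>q \<in> C\<close> \<open>q' \<in> C\<close> order_refl by metis
      have "(INF q\<in>C. q (x + y)) \<le> m x + m y"
        using low[OF m(1)] sublinear_add[OF sub[OF m(1)]] order_trans by blast
      moreover have "m x \<le> q' x" "m y \<le> q y" using m by (auto simp: le_fun_def)
      ultimately show ?thesis by linarith
    qed
    have "(INF q\<in>C. q (x + y)) - (INF q\<in>C. q y) \<le> q' x" if "q' \<in> C" for q'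
    proof -
      have "(INF q\<in>C. q (x + y)) - q' x \<le> (INF q\<in>C. q y)"
        using * that by (intro cINF_greatest[OF ne])
      then show ?thesis by simp
    qed
    then have "(INF q\<in>C. q (x + y)) - (INF q\<in>C. q y) \<le> (INF q\<in>C. q x)"
      by (rule cINF_greatest[OF ne])
    then show "(INF q\<in>C. q (x + y)) \<le> (INF q\<in>C. q x) + (INF q\<in>C. q y)" by simp
  next
    fix r :: real and x assume r: "0 < r"
    have "(INF q\<in>C. q (r *\<^sub>R x)) / r \<le> q x" if "q \<in> C" for q
      using low[OF that, of "r *\<^sub>R x"] r
      by (simp add: sublinear_scale[OF sub[OF that] r] pos_divide_le_eq mult.commute)
    then have "(INF q\<in>C. q (r *\<^sub>R x)) / r \<le> (INF q\<in>C. q x)"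
      by (rule cINF_greatest[OF ne])
    then show "(INF q\<in>C. q (r *\<^sub>R x)) \<le> r * (INF q\<in>C. q x)"
      using r by (simp add: pos_divide_le_eq mult.commute)
  qed
qed

text \<open>A minimal sublinear functional coincides with all its lowerings, hence is odd.\<close>

lemma linear_below_sublinear:
  fixes p :: "'a::real_vector \<Rightarrow> real"
  assumes p: "sublinear p"
  obtains u where "linear u" "\<And>x. u x \<le> p x"
proof -
  let ?A = "{q. sublinear q \<and> q \<le> p}"
  have "\<exists>m\<in>?A. \<forall>a\<in>?A. a \<le> m \<longrightarrow> a = m"
  proof (rule predicate_Zorn)
    \<comment> \<open>The order is reversed, so that Zorn's lemma delivers a minimal
      element.\<close>
    show "partial_order_on ?A (relation_of (\<lambda>a b. b \<le> a) ?A)"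
      by (rule partial_order_on_relation_ofI) auto
    fix C assume C: "C \<in> Chains (relation_of (\<lambda>a b. b \<le> a) ?A)"
    show "\<exists>u\<in>?A. \<forall>a\<in>C. u \<le> a"
    proof (cases "C = {}")
      case True then show ?thesis using p by auto
    next
      case False
      have CA: "sublinear q" "q x \<le> p x" if "q \<in> C" for q x
        using C that unfolding Chains_def relation_of_def by (auto simp: le_fun_def)
      have chain: "q \<le> q' \<or> q' \<le> q" if "q \<in> C" "q' \<in> C" for q q'
        using C that unfolding Chains_def relation_of_def by blast
      have inf: "sublinear (\<lambda>x. INF q\<in>C. q x)" "\<And>q x. q \<in> C \<Longrightarrow> (INF q\<in>C. q x) \<le> q x"
        by (rule sublinear_Inf_chain[of C p]; use False CA chain in blast)+
      obtain q where "q \<in> C" using False by blast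
      then have "(INF q\<in>C. q x) \<le> p x" for x
        using inf(2)[of q x] CA(2)[of q x] by linarith
      then show ?thesis
        using inf by (intro bexI[of _ "\<lambda>x. INF q\<in>C. q x"]) (auto simp: le_fun_def)
    qed
  qed
  then obtain m where m: "sublinear m" "m \<le> p"
    and min: "\<And>a. sublinear a \<Longrightarrow> a \<le> p \<Longrightarrow> a \<le> m \<Longrightarrow> a = m" by blast
  have "m (- x) = - m x" for x
  proof -
    have "lower_along m x \<le> m" by (simp add: le_fun_def lower_along_le_self[OF m(1)])
    then have "lower_along m x = m"
      using min[OF sublinear_lower_along[OF m(1)]] m(2) by auto
    then show ?thesis
      using lower_along_minus[OF m(1), of x] sublinear_minus[OF m(1), of x] by simp
  qed
  then have "linear m" by (rule sublinear_linear_if_odd[OF m(1)])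
  then show ?thesis using m(2) that by (auto simp: le_fun_def)
qed

text \<open>No functional is extended from the line through \<open>x\<close>. Instead the norm is
  first lowered along \<open>x\<close>: every linear \<open>u\<close> below the result has
  \<open>u (- x)\<close> at most \<open>- norm x\<close>, which forces equality at
  \<open>x\<close>.\<close>

lemma real_support_functional:
  fixes x :: "'a::real_normed_vector"
  obtains u :: "'a \<Rightarrow> real" where "linear u" "\<And>v. u v \<le> norm v" "u x = norm x"
proof -
  obtain u where u: "linear u" "\<And>v. u v \<le> lower_along norm x v"
    using linear_below_sublinear[OF sublinear_lower_along[OF sublinear_norm]] by blast
  have le: "u v \<le> norm v" for v
    using u(2)[of v] lower_along_le_self[OF sublinear_norm, of x v] by linarith
  have "u (- x) \<le> - norm x"
    using u(2)[of "- x"] lower_along_minus[OF sublinear_norm, of x] by linarith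
  then have "u x = norm x" using le[of x] linear_neg[OF u(1), of x] by simp
  with u(1) le that show ?thesis by blast
qed

subsection \<open>Functionals over the scalar field\<close>

definition dual_ball ::
  "('k::real_or_complex \<Rightarrow> 'x::real_normed_vector \<Rightarrow> 'x) \<Rightarrow> ('x \<Rightarrow> 'k) set" where
  "dual_ball s = {f. Vector_Spaces.linear s (*) f \<and> (\<forall>v. norm (f v) \<le> norm v)}"

lemma dual_ball_add: "f \<in> dual_ball s \<Longrightarrow> f (x + y) = f x + f y"
  and dual_ball_scale: "f \<in> dual_ball s \<Longrightarrow> f (s c x) = c * f x"
  and dual_ball_le: "f \<in> dual_ball s \<Longrightarrow> norm (f x) \<le> norm x"
  by (simp_all add: dual_ball_def Vector_Spaces.linear_iff)

lemma dual_ball_diff: "f \<in> dual_ball s \<Longrightarrow> f (x - y) = f x - f y"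
  using dual_ball_add[of f s "x - y" y] by simp

lemma dual_ballI:
  assumes "vector_space s" "\<And>x y. f (x + y) = f x + f y" "\<And>c x. f (s c x) = c * f x"
    "\<And>x. norm (f x) \<le> norm x"
  shows "f \<in> dual_ball s"
  using assms vector_space_over_itself.vector_space_axioms
  by (simp add: dual_ball_def Vector_Spaces.linear_iff)

text \<open>Over the complex numbers this is the classical \<open>f x = u x - i * u (i x)\<close>;
  over the reals \<open>f\<close> is \<open>u\<close> itself. The function \<open>re\<close> is the
  real part on the abstract field, and its last property recovers a scalar whose real part equals
  its modulus.\<close>

lemma real_or_complex_linear_extension:
  fixes s :: "'k::real_or_complex \<Rightarrow> 'a::banach \<Rightarrow> 'a" and u :: "'a \<Rightarrow> real"
  assumes "banach_space_over s" and u: "linear u"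
  obtains f and re :: "'k \<Rightarrow> real"
  where "\<And>x y. f (x + y) = f x + f y" "\<And>c x. f (s c x) = c * f x" "\<And>x. re (f x) = u x"
    "\<And>r. re (of_real r) = r" "\<And>k. re k \<le> norm k" "\<And>k. re k = norm k \<Longrightarrow> k = of_real (norm k)"
proof -
  interpret S: banach_space_over s by fact
  obtain e :: "'k \<Rightarrow> complex" where
    e_add: "\<And>x y. e (x + y) = e x + e y" and e_mult: "\<And>x y. e (x * y) = e x * e y"
    and e_real: "\<And>r. e (of_real r) = of_real r" and e_norm: "\<And>x. cmod (e x) = norm x"
    and e_range: "range e = \<real> \<or> range e = UNIV"
    using real_or_complex_embedding[where 'a='k] unfolding of_real_def[symmetric] by blast
  have e_diff: "e (x - y) = e x - e y" for x y using e_add[of "x - y" y] by simp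
  have inj: "x = y" if "e x = e y" for x y
    using e_norm[of "x - y"] that by (simp add: e_diff)
  define re where "re = (\<lambda>k. Re (e k))"
  have re_real: "re (of_real r) = r" for r by (simp add: re_def e_real)
  have re_le: "re k \<le> norm k" for k
    using complex_Re_le_cmod[of "e k"] by (simp add: re_def e_norm)
  have re_norm: "k = of_real (norm k)" if "re k = norm k" for k
  proof -
    have "Im (e k) = 0"
      using that cmod_power2[of "e k"] by (simp add: re_def e_norm)
    then show ?thesis using that by (intro inj) (simp add: e_real complex_eq_iff re_def)
  qed
  have u_add: "u (x + y) = u x + u y" and u_scale: "u (r *\<^sub>R x) = r * u x" for x y r
    using u by (simp_all add: linear_add linear_scale)
  show ?thesis
  proof (cases "range e = \<real>")
    case True
    have k: "k = of_real (re k)" for k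
    proof -
      have "e k \<in> \<real>" using True by blast
      then show ?thesis by (intro inj) (auto simp: re_def e_real Reals_def)
    qed
    define f :: "'a \<Rightarrow> 'k" where "f x = of_real (u x)" for x
    show ?thesis
    proof (rule that[of f re])
      show "f (s c x) = c * f x" for c x
        using S.scale_of_real[of "re c" x] u_scale[of "re c" x] k[of c] by (simp add: f_def)
    qed (use re_real re_le re_norm in \<open>auto simp: f_def u_add\<close>)
  next
    case False
    \<comment> \<open>Here \<open>e\<close> is onto, so the scalar field contains a square root of
      -1.\<close>
    then obtain i where i: "e i = \<i>" using e_range by (metis UNIV_I image_iff)
    have ii: "i * i = - 1"
      using e_real[of 1] e_real[of "- 1"] by (intro inj) (simp add: e_mult i)
    have ii': "i * (i * x) = - x" for x
      using ii by (simp flip: mult.assoc)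
    define f where "f x = of_real (u x) - i * of_real (u (s i x))" for x
    show ?thesis
    proof (rule that[of f re])
      show "f (x + y) = f x + f y" for x y
        by (simp add: f_def u_add S.scale_right_distrib distrib_left)
      show "re (f x) = u x" for x
        by (simp add: f_def re_def e_diff e_mult e_real i)
      show "f (s c x) = c * f x" for c x
      proof -
        \<comment> \<open>Homogeneity is checked by expanding \<open>s c x\<close> and
          \<open>s i (s c x)\<close> as real combinations of \<open>x\<close> and
          \<open>s i x\<close>.\<close>
        define a b where "a = Re (e c)" and "b = Im (e c)"
        have c: "c = of_real a + of_real b * i"
          by (rule inj) (simp add: e_add e_mult e_real i a_def b_def complex_eq_iff)
        have 1: "s c x = a *\<^sub>R x + b *\<^sub>R s i x"
          by (simp add: c S.scale_left_distrib S.scale_of_real flip: S.scale_scale)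
        have "i * c = of_real a * i + of_real (- b)" by (simp add: c ii' algebra_simps)
        then have 2: "s i (s c x) = a *\<^sub>R s i x + (- b) *\<^sub>R x"
          using S.scale_of_real[of a "s i x"] S.scale_of_real[of "- b" x]
          by (simp add: S.scale_left_distrib del: of_real_minus)
        have "f (s c x) = of_real (a * u x + b * u (s i x)) - i * of_real (a * u (s i x) + - b * u x)"
          unfolding f_def 2 unfolding 1 u_add u_scale ..
        also have "\<dots> = (of_real a + of_real b * i) * f x"
          by (simp add: f_def ii' algebra_simps)
        finally show ?thesis by (simp flip: c)
      qed
    qed (use re_real re_le re_norm in auto)
  qed
qed

lemma support_functional:
  fixes s :: "'k::real_or_complex \<Rightarrow> 'a::banach \<Rightarrow> 'a"
  assumes s: "banach_space_over s"
  obtains f where "f \<in> dual_ball s" "f x = of_real (norm x)"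
proof -
  interpret S: banach_space_over s by fact
  obtain u :: "'a \<Rightarrow> real" where u: "linear u" "\<And>v. u v \<le> norm v" "u x = norm x"
    using real_support_functional by blast
  obtain f and re :: "'k \<Rightarrow> real" where f: "\<And>x y. f (x + y) = f x + f y" "\<And>c x. f (s c x) = c * f x"
    and re: "\<And>x. re (f x) = u x" "\<And>r. re (of_real r) = r"
    "\<And>k. re k \<le> norm k" "\<And>k. re k = norm k \<Longrightarrow> k = of_real (norm k)"
    using real_or_complex_linear_extension[OF s u(1)] by blast
  have le: "norm (f v) \<le> norm v" for v
  proof (cases "f v = 0")
    case False
    \<comment> \<open>Rotating \<open>v\<close> by this unimodular scalar makes the value of
      \<open>f\<close> real and nonnegative, so the bound on its real part \<open>u\<close> bounds
      its modulus.\<close>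
    define k where "k = of_real (norm (f v)) / f v"
    have "norm k = 1" using False by (simp add: k_def norm_divide)
    have "f (s k v) = of_real (norm (f v))" using False by (simp add: f(2) k_def)
    then have "norm (f v) = u (s k v)" using re(1)[of "s k v"] re(2) by simp
    also have "\<dots> \<le> norm v" using u(2)[of "s k v"] \<open>norm k = 1\<close> by (simp add: S.norm_scale)
    finally show ?thesis .
  qed simp
  have "f \<in> dual_ball s" using f le S.vector_space_axioms by (intro dual_ballI)
  moreover have "f x = of_real (norm x)"
  proof -
    have "norm (f x) = norm x"
      using re(1)[of x] re(3)[of "f x"] u(3) le[of x] by simp
    then show ?thesis using re(1)[of x] re(4)[of "f x"] u(3) by simp
  qed
  ultimately show ?thesis by (rule that)
qed

lemma bounded_ops_bounded_linear:
  assumes "T \<in> bounded_ops sX sY"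
    and "\<And>r x. sX (of_real r) x = r *\<^sub>R x" and "\<And>r y. sY (of_real r) y = r *\<^sub>R y"
  shows "bounded_linear T"
proof -
  obtain C where lin: "Vector_Spaces.linear sX sY T" and C: "\<And>x. norm (T x) \<le> C * norm x"
    using assms(1) by (auto simp: bounded_ops_def)
  show ?thesis
  proof (rule bounded_linear_intro)
    show "T (x + y) = T x + T y" for x y using lin by (simp add: Vector_Spaces.linear_iff)
    show "T (r *\<^sub>R x) = r *\<^sub>R T x" for r x
      using lin unfolding Vector_Spaces.linear_iff by (metis assms(2,3))
    show "norm (T x) \<le> norm x * C" for x using C[of x] by (simp add: mult.commute)
  qed
qed

text \<open>A functional in the dual ball with value 1 at a unit vector automatically has norm
  exactly 1, so operator norms can be replaced by pointwise bounds from here on.\<close>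

lemma states_iff:
  assumes s: "banach_space_over s"
  shows "(x, f) \<in> states s \<longleftrightarrow> norm x = 1 \<and> f \<in> dual_ball s \<and> f x = 1"
proof -
  interpret S: banach_space_over s by fact
  have bl: "bounded_linear f" if "f \<in> dual_space s"
    using that by (rule bounded_ops_bounded_linear) (simp_all add: S.scale_of_real scaleR_conv_of_real)
  have 1: "f \<in> dual_ball s" if "f \<in> dual_space s" "onorm f = 1"
    using that onorm[OF bl[OF that(1)]] by (simp add: dual_ball_def bounded_ops_def)
  have 2: "f \<in> dual_space s" if "f \<in> dual_ball s"
    using that by (auto simp: dual_ball_def bounded_ops_def intro!: exI[of _ 1])
  have 3: "onorm f = 1" if "f \<in> dual_ball s" "norm x = 1" "f x = 1"
  proof (rule order_antisym)
    show "onorm f \<le> 1" by (rule onorm_bound) (simp_all add: dual_ball_le[OF that(1)])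
    show "1 \<le> onorm f" using le_onorm[OF bl[OF 2[OF that(1)]], of x] that by simp
  qed
  show ?thesis unfolding states_def using 1 2 3 by auto
qed

text \<open>
  A form of Smulian's duality between uniform smoothness of a space and uniform convexity of its
  dual. If \<open>g x = c\<close>, test the difference \<open>g - f\<close> on a short vector \<open>y\<close>, rotated so that
  \<open>(g - f) y\<close> is a nonnegative multiple of \<open>c\<close>; then \<open>f (x - y) + g (x + y)\<close> has modulus about
  \<open>2 + norm ((g - f) y)\<close>, while smoothness bounds it by \<open>2 + o(norm y)\<close>.
\<close>

lemma uniformly_smooth_support_functional:
  fixes s :: "'k::real_or_complex \<Rightarrow> 'a::banach \<Rightarrow> 'a"
  assumes s: "banach_space_over s" and smooth: "uniformly_smooth TYPE('a)" and "0 < \<epsilon>"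
  obtains \<delta> where "0 < \<delta>"
    "\<And>f x c. f \<in> dual_ball s \<Longrightarrow> norm x = 1 \<Longrightarrow> norm c = 1 \<Longrightarrow> norm (f x - c) < \<delta> \<Longrightarrow>
      \<exists>g \<in> dual_ball s. g x = c \<and> (\<forall>v. norm (g v - f v) \<le> \<epsilon> * norm v)"
proof -
  interpret S: banach_space_over s by fact
  obtain \<tau> where \<tau>: "0 < \<tau>" and sm: "\<And>x y :: 'a. norm x = 1 \<Longrightarrow> norm y \<le> \<tau> \<Longrightarrow>
      norm (x + y) + norm (x - y) \<le> 2 + \<epsilon> / 2 * norm y"
    using smooth \<open>0 < \<epsilon>\<close> unfolding uniformly_smooth_def by (meson half_gt_zero)
  show ?thesis
  \<comment> \<open>The test vector \<open>y\<close> below has norm \<tau>. Smoothness then costs at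
    most \<epsilon>\<tau>/2, and replacing \<open>f x\<close> by \<open>c\<close> costs less than
    the same amount again, so the total excess over 2 is below \<epsilon>\<tau>.\<close>
  proof (rule that[of "\<epsilon> * \<tau> / 2"])
    show "0 < \<epsilon> * \<tau> / 2" using \<tau> \<open>0 < \<epsilon>\<close> by simp
    fix f x and c :: 'k
    assume f: "f \<in> dual_ball s" and x: "norm x = 1" and c: "norm c = 1"
      and fx: "norm (f x - c) < \<epsilon> * \<tau> / 2"
    \<comment> \<open>The candidate is a support functional at \<open>x\<close> rotated by
      \<open>c\<close>, chosen independently of \<open>f\<close>; smoothness alone forces it to be
      close to \<open>f\<close>.\<close>
    obtain h where h: "h \<in> dual_ball s" "h x = of_real (norm x)"
      using support_functional[OF s] by blast
    define g where "g v = c * h v" for v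
    have g: "g \<in> dual_ball s"
      using S.vector_space_axioms
      by (rule dual_ballI) (simp_all add: g_def dual_ball_add[OF h(1)] dual_ball_scale[OF h(1)]
        dual_ball_le[OF h(1)] norm_mult c distrib_left)
    have gx: "g x = c" using h(2) x by (simp add: g_def)
    have "norm (g v - f v) \<le> \<epsilon> * norm v" for v
    proof (cases "g v = f v")
      case False
      define D where "D = g v - f v"
      have D: "D \<noteq> 0" using False by (simp add: D_def)
      have v: "v \<noteq> 0" using False S.scale_zero_left[of v] dual_ball_scale[OF f, of 0 v]
        dual_ball_scale[OF g, of 0 v] by auto
      define t where "t = \<tau> / norm v"
      have t: "0 < t" using \<tau> v by (simp add: t_def)
      define y where "y = s (c * of_real (norm D * t) / D) v"
      have ny: "norm y = \<tau>"
        using D v \<tau> t by (simp add: y_def S.norm_scale norm_mult norm_divide c) (simp add: t_def)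
      have "g y - f y = (c * of_real (norm D * t) / D) * D"
        unfolding y_def dual_ball_scale[OF f] dual_ball_scale[OF g] D_def right_diff_distrib ..
      also have "\<dots> = c * of_real (norm D * t)" using D by simp
      finally have gf: "g y - f y = c * of_real (norm D * t)" .
      have eq: "of_real (2 + norm D * t) * c = f (x - y) + g (x + y) - (f x - c)"
        using gf by (simp add: dual_ball_diff[OF f] dual_ball_add[OF g] gx algebra_simps)
      have "2 + norm D * t = norm (of_real (2 + norm D * t) * c)"
        using t D by (simp only: norm_mult c norm_of_real) simp
      also have "\<dots> \<le> norm (f (x - y)) + norm (g (x + y)) + norm (f x - c)"
        unfolding eq by (meson add_mono norm_triangle_ineq norm_triangle_ineq4 order_refl order_trans)
      also have "\<dots> < norm (x - y) + norm (x + y) + \<epsilon> * \<tau> / 2"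
        using dual_ball_le[OF f, of "x - y"] dual_ball_le[OF g, of "x + y"] fx by linarith
      also have "\<dots> \<le> 2 + \<epsilon> * \<tau>"
        using sm[OF x, of y] ny by (simp add: field_simps)
      finally have "norm D * \<tau> < \<epsilon> * norm v * \<tau>"
        using v by (simp add: t_def field_simps)
      then show ?thesis using \<tau> by (simp add: D_def)
    qed (use \<open>0 < \<epsilon>\<close> in simp)
    with g gx show "\<exists>g \<in> dual_ball s. g x = c \<and> (\<forall>v. norm (g v - f v) \<le> \<epsilon> * norm v)" by blast
  qed
qed

section \<open>Functionals on the direct sum\<close>

lemma norm_l1_fst_le: "norm (l1_fst p) \<le> norm p"
  by (simp add: norm_l1_sum_def)

text \<open>The dual of an l1-sum carries the maximum norm, so its unit ball is the product of the
  two dual balls.\<close>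

lemma dual_ball_l1_sum:
  assumes W: "banach_space_over sW" and Z: "banach_space_over sZ"
    and f: "f \<in> dual_ball sW" and g: "g \<in> dual_ball sZ"
  shows "(\<lambda>p. f (l1_fst p) + g (l1_snd p)) \<in> dual_ball (l1_scale sW sZ)"
proof (rule dual_ballI)
  show "vector_space (l1_scale sW sZ)"
    using banach_space_over_l1_scale[OF W Z] by (simp add: banach_space_over_def)
  show "norm (f (l1_fst p) + g (l1_snd p)) \<le> norm p" for p
    unfolding norm_l1_sum_def
    by (rule norm_triangle_mono) (simp_all add: dual_ball_le[OF f] dual_ball_le[OF g])
qed (simp_all add: plus_l1_sum_def l1_scale_def dual_ball_add[OF f] dual_ball_add[OF g]
    dual_ball_scale[OF f] dual_ball_scale[OF g] distrib_left)

text \<open>The converse decomposition: each summand embeds isometrically, so restriction keeps a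
  functional in the dual ball.\<close>

lemma dual_ball_l1_components:
  assumes W: "banach_space_over sW" and Z: "banach_space_over sZ"
    and F: "F \<in> dual_ball (l1_scale sW sZ)"
  shows "(\<lambda>w. F (L1 w 0)) \<in> dual_ball sW" and "(\<lambda>z. F (L1 0 z)) \<in> dual_ball sZ"
    and "F (L1 w z) = F (L1 w 0) + F (L1 0 z)"
proof -
  interpret W: banach_space_over sW by fact
  interpret Z: banach_space_over sZ by fact
  show "F (L1 w z) = F (L1 w 0) + F (L1 0 z)"
    by (simp add: plus_l1_sum_def flip: dual_ball_add[OF F])
  show "(\<lambda>w. F (L1 w 0)) \<in> dual_ball sW"
  proof (rule dual_ballI[OF W.vector_space_axioms])
    show "norm (F (L1 w 0)) \<le> norm w" for w
      using dual_ball_le[OF F, of "L1 w 0"] by (simp add: norm_l1_sum_def)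
  qed (simp_all add: plus_l1_sum_def l1_scale_def flip: dual_ball_add[OF F] dual_ball_scale[OF F])
  show "(\<lambda>z. F (L1 0 z)) \<in> dual_ball sZ"
  proof (rule dual_ballI[OF Z.vector_space_axioms])
    show "norm (F (L1 0 z)) \<le> norm z" for z
      using dual_ball_le[OF F, of "L1 0 z"] by (simp add: norm_l1_sum_def)
  qed (simp_all add: plus_l1_sum_def l1_scale_def flip: dual_ball_add[OF F] dual_ball_scale[OF F])
qed

subsection \<open>Norm attainment and numerical radius\<close>

locale norm_one_operator =
  W: banach_space_over sW + Z: banach_space_over sZ
  for sW :: "'k::real_or_complex \<Rightarrow> 'w::banach \<Rightarrow> 'w" and sZ :: "'k \<Rightarrow> 'z::banach \<Rightarrow> 'z" +
  fixes T :: "'w \<Rightarrow> 'z"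
  assumes T_ops: "T \<in> bounded_ops sW sZ" and onorm_T: "onorm T = 1"
begin

lemma W: "banach_space_over sW" and Z: "banach_space_over sZ"
  by unfold_locales

lemmas l1_states_iff = states_iff[OF banach_space_over_l1_scale[OF W Z]]

lemma bounded_linear_T: "bounded_linear T"
  using T_ops by (rule bounded_ops_bounded_linear) (simp_all add: W.scale_of_real Z.scale_of_real)

lemma norm_T_le: "norm (T w) \<le> norm w"
  using onorm[OF bounded_linear_T, of w] onorm_T by simp

lemma norm_functional_tilde_le:
  assumes "F \<in> dual_ball (l1_scale sW sZ)"
  shows "norm (F (tilde_op T p)) \<le> norm (T (l1_fst p))"
  using dual_ball_le[OF assms, of "tilde_op T p"] by (simp add: tilde_op_def norm_l1_sum_def)

text \<open>The point has second coordinate 0, so \<open>g\<close> does not enter the pairing and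
  remains free to be chosen at \<open>T w\<close>.\<close>

lemma l1_state:
  assumes f: "f \<in> dual_ball sW" and g: "g \<in> dual_ball sZ" and "norm w = 1" "f w = 1"
  shows "(L1 w 0, \<lambda>p. f (l1_fst p) + g (l1_snd p)) \<in> states (l1_scale sW sZ)"
  using dual_ball_l1_sum[OF W Z f g] dual_ball_diff[OF g, of 0 0] assms
  by (simp add: l1_states_iff norm_l1_sum_def)

section \<open>From numerical radius to norm attainment\<close>

lemma A_norm_if_tilde_A_nu:
  assumes "tilde_op T \<in> A_nu (l1_scale sW sZ)"
  shows "T \<in> A_norm sW sZ"
proof -
  let ?X = "l1_scale sW sZ"
  have attain: "attains_numerical_radius ?X (tilde_op T)" "numerical_radius ?X (tilde_op T) = 1"
    and nu: "\<And>\<epsilon>. 0 < \<epsilon> \<Longrightarrow> \<exists>\<eta>>0. \<forall>(x, x') \<in> states ?X. norm (x' (tilde_op T x)) > 1 - \<eta> \<longrightarrow>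
        (\<exists>(x0, x0') \<in> states ?X. norm (x0' (tilde_op T x0)) = 1 \<and>
           norm (x0 - x) < \<epsilon> \<and> onorm (\<lambda>y. x0' y - x' y) < \<epsilon>)"
    using assms by (auto simp: A_nu_def)
  \<comment> \<open>Everything is squeezed in the chain from 1 through
    \<open>norm (T (l1_fst p))\<close> and \<open>norm (l1_fst p)\<close> to
    \<open>norm p = 1\<close>.\<close>
  have key: "norm (l1_fst p) = 1 \<and> norm (T (l1_fst p)) = 1"
    if "(p, F) \<in> states ?X" "norm (F (tilde_op T p)) = 1" for p F
  proof -
    have "1 \<le> norm (T (l1_fst p))"
      using that norm_functional_tilde_le[of F p] by (simp add: l1_states_iff)
    moreover have "norm (l1_fst p) \<le> 1"
      using that norm_l1_fst_le[of p] by (simp add: l1_states_iff)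
    ultimately show ?thesis using norm_T_le[of "l1_fst p"] by linarith
  qed
  have "attains_norm T"
    using attain key by (fastforce simp: attains_norm_def attains_numerical_radius_def onorm_T)
  moreover have "\<exists>\<eta>>0. \<forall>x \<in> sphere 0 1. norm (T x) > 1 - \<eta> \<longrightarrow>
        (\<exists>x0 \<in> sphere 0 1. norm (T x0) = 1 \<and> norm (x0 - x) < \<epsilon>)" if \<epsilon>: "0 < \<epsilon>" for \<epsilon>
  proof -
    obtain \<eta> where "0 < \<eta>" and \<eta>: "\<And>x x'. (x, x') \<in> states ?X \<Longrightarrow> norm (x' (tilde_op T x)) > 1 - \<eta> \<Longrightarrow>
        \<exists>(x0, x0') \<in> states ?X. norm (x0' (tilde_op T x0)) = 1 \<and>
           norm (x0 - x) < \<epsilon> \<and> onorm (\<lambda>y. x0' y - x' y) < \<epsilon>"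
      using nu[OF \<epsilon>] by blast
    have "\<exists>x0 \<in> sphere 0 1. norm (T x0) = 1 \<and> norm (x0 - x) < \<epsilon>"
      if x: "norm x = 1" "norm (T x) > 1 - \<eta>" for x
    proof -
      obtain f where f: "f \<in> dual_ball sW" "f x = of_real (norm x)"
        using support_functional[OF W] by blast
      obtain g where g: "g \<in> dual_ball sZ" "g (T x) = of_real (norm (T x))"
        using support_functional[OF Z] by blast
      have "(L1 x 0, \<lambda>p. f (l1_fst p) + g (l1_snd p)) \<in> states ?X"
        using f g x by (intro l1_state) simp_all
      \<comment> \<open>At this state the functional takes the value \<open>norm (T x)\<close> on
        the image of the point, so the same \<eta> serves for \<open>T\<close>.\<close>
      from \<eta>[OF this] obtain p F where p: "(p, F) \<in> states ?X" "norm (F (tilde_op T p)) = 1"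
        "norm (p - L1 x 0) < \<epsilon>"
        using x g(2) dual_ball_diff[OF f(1), of 0 0] by (auto simp: tilde_op_def)
      have "norm (l1_fst p - x) \<le> norm (p - L1 x 0)"
        by (simp add: norm_l1_sum_def minus_l1_sum_def)
      with p(3) key[OF p(1,2)] show ?thesis by (intro bexI[of _ "l1_fst p"]) auto
    qed
    with \<open>0 < \<eta>\<close> show ?thesis by (intro exI[of _ \<eta>]) auto
  qed
  ultimately show ?thesis using T_ops onorm_T by (auto simp: A_norm_def)
qed

section \<open>From norm attainment to numerical radius\<close>

lemma numerical_radius_tilde:
  assumes "norm w = 1" "norm (T w) = 1"
  shows "attains_numerical_radius (l1_scale sW sZ) (tilde_op T)"
    and "numerical_radius (l1_scale sW sZ) (tilde_op T) = 1"
proof -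
  let ?X = "l1_scale sW sZ"
  obtain f where f: "f \<in> dual_ball sW" "f w = of_real (norm w)"
    using support_functional[OF W] by blast
  obtain g where g: "g \<in> dual_ball sZ" "g (T w) = of_real (norm (T w))"
    using support_functional[OF Z] by blast
  define F where "F p = f (l1_fst p) + g (l1_snd p)" for p
  have st: "(L1 w 0, F) \<in> states ?X"
    unfolding F_def using f g assms by (intro l1_state) simp_all
  have F: "norm (F (tilde_op T (L1 w 0))) = 1"
    using g(2) assms dual_ball_diff[OF f(1), of 0 0] by (simp add: F_def tilde_op_def)
  \<comment> \<open>With this bound the state built from support functionals at \<open>w\<close> and
    \<open>T w\<close> realises the supremum as a maximum.\<close>
  have le: "norm (x' (tilde_op T x)) \<le> 1" if "(x, x') \<in> states ?X" for x x'
  proof -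
    have "norm (x' (tilde_op T x)) \<le> norm (l1_fst x)"
      using that norm_functional_tilde_le[of x' x] norm_T_le[of "l1_fst x"]
      by (simp add: l1_states_iff)
    also have "\<dots> \<le> 1" using that norm_l1_fst_le[of x] by (simp add: l1_states_iff)
    finally show ?thesis .
  qed
  show radius: "numerical_radius ?X (tilde_op T) = 1"
    unfolding numerical_radius_def
  proof (rule cSup_eq_maximum)
    show "1 \<in> (\<lambda>(x, x'). norm (x' (tilde_op T x))) ` states ?X"
      using st F by (intro image_eqI[of _ _ "(L1 w 0, F)"]) simp_all
  qed (use le in auto)
  show "attains_numerical_radius ?X (tilde_op T)"
    unfolding attains_numerical_radius_def radius using st F by (intro bexI[of _ "(L1 w 0, F)"]) simp_all
qed

lemma tilde_A_nu_if_A_norm: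
  assumes smooth: "uniformly_smooth TYPE('w)" "uniformly_smooth TYPE('z)"
    and A: "T \<in> A_norm sW sZ"
  shows "tilde_op T \<in> A_nu (l1_scale sW sZ)"
proof -
  let ?X = "l1_scale sW sZ"
  have attain: "attains_norm T" and nrm: "\<And>\<epsilon>. 0 < \<epsilon> \<Longrightarrow> \<exists>\<eta>>0. \<forall>x \<in> sphere 0 1. norm (T x) > 1 - \<eta> \<longrightarrow>
        (\<exists>x0 \<in> sphere 0 1. norm (T x0) = 1 \<and> norm (x0 - x) < \<epsilon>)"
    using A by (auto simp: A_norm_def)
  obtain w1 where w1: "norm w1 = 1" "norm (T w1) = 1"
    using attain by (auto simp: attains_norm_def onorm_T)
  interpret T: bounded_linear T by (rule bounded_linear_T)
  have "\<exists>\<eta>>0. \<forall>(x, x') \<in> states ?X. norm (x' (tilde_op T x)) > 1 - \<eta> \<longrightarrow>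
        (\<exists>(x0, x0') \<in> states ?X. norm (x0' (tilde_op T x0)) = 1 \<and>
           norm (x0 - x) < \<epsilon> \<and> onorm (\<lambda>y. x0' y - x' y) < \<epsilon>)" if \<epsilon>: "0 < \<epsilon>" for \<epsilon>
  proof -
    obtain \<delta>W where \<delta>W: "0 < \<delta>W"
      "\<And>f x c. f \<in> dual_ball sW \<Longrightarrow> norm x = 1 \<Longrightarrow> norm c = 1 \<Longrightarrow> norm (f x - c) < \<delta>W \<Longrightarrow>
        \<exists>g \<in> dual_ball sW. g x = c \<and> (\<forall>v. norm (g v - f v) \<le> \<epsilon> / 2 * norm v)"
      using uniformly_smooth_support_functional[OF W smooth(1), of "\<epsilon> / 2"] \<epsilon> by auto
    obtain \<delta>Z where \<delta>Z: "0 < \<delta>Z"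
      "\<And>f x c. f \<in> dual_ball sZ \<Longrightarrow> norm x = 1 \<Longrightarrow> norm c = 1 \<Longrightarrow> norm (f x - c) < \<delta>Z \<Longrightarrow>
        \<exists>g \<in> dual_ball sZ. g x = c \<and> (\<forall>v. norm (g v - f v) \<le> \<epsilon> / 2 * norm v)"
      using uniformly_smooth_support_functional[OF Z smooth(2), of "\<epsilon> / 2"] \<epsilon> by auto
    \<comment> \<open>Each estimate below collects three errors of size at most \<alpha>: the move
      from \<open>w'\<close> to \<open>w0\<close> and two defects bounded by \<eta>. The entry 1 in
      the minimum keeps \<open>w\<close> and the later scalar \<open>a\<close> away from 0.\<close>
    define \<alpha> where "\<alpha> = Min {\<epsilon>, \<delta>W, \<delta>Z, 1} / 3"
    have \<alpha>: "0 < \<alpha>" "3 * \<alpha> \<le> \<epsilon>" "3 * \<alpha> \<le> \<delta>W" "3 * \<alpha> \<le> \<delta>Z" "3 * \<alpha> \<le> 1"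
      using \<epsilon> \<delta>W(1) \<delta>Z(1) by (auto simp: \<alpha>_def)
    obtain \<eta>' where \<eta>': "0 < \<eta>'" "\<And>x. norm x = 1 \<Longrightarrow> norm (T x) > 1 - \<eta>' \<Longrightarrow>
        \<exists>x0. norm x0 = 1 \<and> norm (T x0) = 1 \<and> norm (x0 - x) < \<alpha>"
      using nrm[OF \<alpha>(1)] by (force simp: dist_norm)
    define \<eta> where "\<eta> = min \<eta>' \<alpha>"
    have \<eta>: "0 < \<eta>" "\<eta> \<le> \<eta>'" "\<eta> \<le> \<alpha>" using \<alpha> \<eta>' by (auto simp: \<eta>_def)
    have "\<exists>(x0, x0') \<in> states ?X. norm (x0' (tilde_op T x0)) = 1 \<and>
           norm (x0 - p) < \<epsilon> \<and> onorm (\<lambda>y. x0' y - F y) < \<epsilon>"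
      if st: "(p, F) \<in> states ?X" and near: "norm (F (tilde_op T p)) > 1 - \<eta>" for p F
    proof -
      obtain w z where p: "p = L1 w z" by (cases p)
      have F: "F \<in> dual_ball ?X" and Fp: "F (L1 w z) = 1" and wz: "norm w + norm z = 1"
        using st by (simp_all add: l1_states_iff p norm_l1_sum_def)
      note comp = dual_ball_l1_components[OF W Z F]
      define f where "f v = F (L1 v 0)" for v
      define g where "g v = F (L1 0 v)" for v
      have f: "f \<in> dual_ball sW" and g: "g \<in> dual_ball sZ"
        using comp(1,2) by (simp_all add: f_def[abs_def] g_def[abs_def])
      have fg: "f w + g z = 1" using comp(3)[of w z] Fp by (simp add: f_def g_def)
      have gT: "norm (g (T w)) > 1 - \<eta>" using near by (simp add: p tilde_op_def g_def)
      then have Tw: "norm (T w) > 1 - \<eta>" using dual_ball_le[OF g, of "T w"] by linarith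
      then have w: "norm w > 1 - \<eta>" using norm_T_le[of w] by linarith
      then have "w \<noteq> 0" using \<eta>(3) \<alpha>(5) \<alpha>(1) by auto
      have w_le: "norm w \<le> 1" using wz norm_ge_zero[of z] by linarith
      \<comment> \<open>The hypothesis on \<open>T\<close> concerns unit vectors only. Normalising
        does not decrease \<open>norm (T w)\<close>, and it moves \<open>w\<close> by just
        \<open>1 - norm w\<close>, which is also \<open>norm z\<close>.\<close>
      define w' where "w' = w /\<^sub>R norm w"
      have "norm w' = 1" using \<open>w \<noteq> 0\<close> by (simp add: w'_def)
      moreover have "norm (T w) \<le> norm (T w')"
        using \<open>w \<noteq> 0\<close> w_le mult_left_mono[OF w_le, of "norm (T w)"]
        by (simp add: w'_def T.scaleR field_simps)
      then have "norm (T w') > 1 - \<eta>'" using Tw \<eta>(2) by linarith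
      ultimately obtain w0 where w0: "norm w0 = 1" "norm (T w0) = 1" "norm (w0 - w') < \<alpha>"
        using \<eta>'(2) by blast
      have "w' - w = (1 - norm w) *\<^sub>R w'"
        using \<open>w \<noteq> 0\<close> by (simp add: w'_def algebra_simps)
      then have "norm (w' - w) = 1 - norm w" using w_le \<open>norm w' = 1\<close> by simp
      then have w0w: "norm (w0 - w) < \<alpha> + (1 - norm w)"
        using w0(3) norm_triangle_ineq[of "w0 - w'" "w' - w"] by simp
      \<comment> \<open>Since \<open>f w + g z = 1\<close>, the defect of \<open>f\<close> at
        \<open>w0\<close> comes only from moving \<open>w\<close> and from the small vector
        \<open>z\<close>.\<close>
      have "f w0 - 1 = f (w0 - w) - g z"
        using fg by (simp add: dual_ball_diff[OF f] algebra_simps)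
      then have "norm (f w0 - 1) \<le> norm (w0 - w) + norm z"
        using norm_triangle_ineq4[of "f (w0 - w)" "g z"] dual_ball_le[OF f, of "w0 - w"]
          dual_ball_le[OF g, of z] by simp
      then have "norm (f w0 - 1) < \<delta>W" using w0w wz w \<eta>(3) \<alpha>(3) by linarith
      then obtain f0 where f0: "f0 \<in> dual_ball sW" "f0 w0 = 1"
        "\<And>v. norm (f0 v - f v) \<le> \<epsilon> / 2 * norm v"
        using \<delta>W(2)[OF f w0(1), of 1] by auto
      \<comment> \<open>Only the modulus of \<open>a\<close> is known to be near 1, so the value
        prescribed for the corrected functional at \<open>T w0\<close> is the phase
        \<open>sgn a\<close>.\<close>
      define a where "a = g (T w0)"
      have "norm (g (T w)) \<le> norm a + norm (g (T (w0 - w)))"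
        using norm_triangle_ineq4[of a "g (T (w0 - w))"]
        by (simp add: a_def T.diff dual_ball_diff[OF g])
      moreover have "norm (g (T (w0 - w))) \<le> norm (w0 - w)"
        using dual_ball_le[OF g, of "T (w0 - w)"] norm_T_le[of "w0 - w"] by linarith
      ultimately have a: "norm a > 1 - 3 * \<alpha>" using gT w0w w \<eta>(3) by linarith
      then have "a \<noteq> 0" using \<alpha>(5) by auto
      have a_le: "norm a \<le> 1" using dual_ball_le[OF g, of "T w0"] w0(2) by (simp add: a_def)
      have "a - sgn a = (norm a - 1) *\<^sub>R sgn a"
        using \<open>a \<noteq> 0\<close> by (simp add: sgn_div_norm algebra_simps)
      then have "norm (a - sgn a) = 1 - norm a"
        using a_le \<open>a \<noteq> 0\<close> by (simp add: norm_sgn)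
      then have "norm (g (T w0) - sgn a) < \<delta>Z" using a \<alpha>(4) by (simp add: a_def)
      then obtain g0 where g0: "g0 \<in> dual_ball sZ" "g0 (T w0) = sgn a"
        "\<And>v. norm (g0 v - g v) \<le> \<epsilon> / 2 * norm v"
        using \<delta>Z(2)[OF g w0(2), of "sgn a"] \<open>a \<noteq> 0\<close> by (auto simp: norm_sgn)
      define F0 where "F0 q = f0 (l1_fst q) + g0 (l1_snd q)" for q
      have "(L1 w0 0, F0) \<in> states ?X"
        unfolding F0_def by (rule l1_state[OF f0(1) g0(1) w0(1) f0(2)])
      moreover have "norm (F0 (tilde_op T (L1 w0 0))) = 1"
        using dual_ball_diff[OF f0(1), of 0 0] \<open>a \<noteq> 0\<close>
        by (simp add: F0_def tilde_op_def g0(2) norm_sgn)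
      moreover have "norm (L1 w0 0 - p) < \<epsilon>"
      proof -
        have "norm (L1 w0 0 - p) = norm (w0 - w) + norm z"
          by (simp add: p norm_l1_sum_def minus_l1_sum_def)
        then show ?thesis using w0w wz w \<eta>(3) \<alpha>(2) by linarith
      qed
      moreover have "onorm (\<lambda>q. F0 q - F q) < \<epsilon>"
      proof -
        \<comment> \<open>The two component errors do not add up: each is at most \<epsilon>/2 times
          the norm of its own coordinate, and these norms sum to \<open>norm q\<close>.\<close>
        have "onorm (\<lambda>q. F0 q - F q) \<le> \<epsilon> / 2"
        proof (rule onorm_bound)
          fix q :: "('w, 'z) l1_sum"
          have "F q = f (l1_fst q) + g (l1_snd q)"
            using comp(3)[of "l1_fst q" "l1_snd q"] by (simp add: f_def g_def)
          then have "F0 q - F q = (f0 (l1_fst q) - f (l1_fst q)) + (g0 (l1_snd q) - g (l1_snd q))"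
            by (simp add: F0_def)
          also have "norm \<dots> \<le> \<epsilon> / 2 * norm (l1_fst q) + \<epsilon> / 2 * norm (l1_snd q)"
            by (rule norm_triangle_mono) (rule f0(3) g0(3))+
          finally show "norm (F0 q - F q) \<le> \<epsilon> / 2 * norm q"
            by (simp add: norm_l1_sum_def distrib_left)
        qed (use \<epsilon> in simp)
        then show ?thesis using \<epsilon> by linarith
      qed
      ultimately show ?thesis by (intro bexI[of _ "(L1 w0 0, F0)"]) auto
    qed
    with \<eta>(1) show ?thesis by (intro exI[of _ \<eta>]) auto
  qed
  then show ?thesis
    using tilde_op_in_bounded_ops[OF W Z T_ops] numerical_radius_tilde[OF w1]
    by (simp add: A_nu_def)
qed

end

theorem proposition3p1:
  fixes sW :: "'k::real_or_complex \<Rightarrow> 'w::banach \<Rightarrow> 'w"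
    and sZ :: "'k \<Rightarrow> 'z::banach \<Rightarrow> 'z"
    and T :: "'w \<Rightarrow> 'z"
  assumes "banach_space_over sW" and "banach_space_over sZ"
    and "T \<in> bounded_ops sW sZ" and "onorm T = 1"
  shows "(tilde_op T \<in> A_nu (l1_scale sW sZ) \<longrightarrow> T \<in> A_norm sW sZ) \<and>
    (uniformly_smooth TYPE('w) \<and> uniformly_smooth TYPE('z) \<longrightarrow>
      T \<in> A_norm sW sZ \<longrightarrow> tilde_op T \<in> A_nu (l1_scale sW sZ))"
proof -
  interpret norm_one_operator sW sZ T
    using assms by (simp add: norm_one_operator_def norm_one_operator_axioms_def)
  show ?thesis using A_norm_if_tilde_A_nu tilde_A_nu_if_A_norm by blast
qed

end
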